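(* Suppose $\max\left\{\frac{|\delta+\mu|}{1+\beta},\frac{|\delta-\mu|}{1-\beta}\right\}\rho(G)<1$, $\mu<\beta\delta$, and $x^{A0}>\mathbf 0$, $x^{B0}>\mathbf 0$. Suppose $\tilde p^{\max}\le p^{\lim}$ (i.e. $\tilde p^{\max}_{(\ell)}\le p^{\lim}_i$ for all $i\in V_{(\ell)}$, $\ell\in[c]$) and $\sum_{\ell=1}^cb_{\Delta(\ell)}\tilde p^{\max}_{(\ell)}\ge k_0$. Let the connected components be ordered in descending order of $\{\gamma_\ell:\ell\in[c]\}$, where $$\gamma_\ell:=\frac{q_{(\ell)}}{b_{\Delta(\ell)}}\left(p^{A0}_{(\ell)}+\tilde p^{\max}_{(\ell)}-\frac{v_{(\ell)}}{q_{(\ell)}}\right),$$ and suppose $p^{A0}_{(\ell)}+\tilde p^{\max}_{(\ell)}\ne\frac{v_{(\ell)}}{q_{(\ell)}}$ for all $\ell\in[c]$. Then the policy $\bar p$ optimally solves either $\widetilde{\boldsymbol P}$ or its convex relaxation (RP), and the optimal value of the relaxed objective function $\tilde\phi_{\mathrm{rel}}$ provides an upper bound on the optimal welfare at equilibrium, i.e. $\phi(p^* )\le\tilde\phi_{\mathrm{rel}}(\bar p)$, where $p^*$ is an optimal solution of $\widetilde{\boldsymbol P}$. Moreover, if $\bar p_{(\ell^* )}\in\{p^{A0}_{(\ell^* )},\tilde p^{\max}_{(\ell^* )}\}$ (regarded as satisfied if $\ell^*=0$), then this upper bound is tight, $\bar p=p^{(\ell^* )}$, and $p^{(\ell^* )}$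 is an optimal solution of $\widetilde{\boldsymbol P}$.
   Context: Network and game. $G\in\{0,1\}^{n\times n}$ is the symmetric, zero-diagonal adjacency matrix of an undirected graph on $n$ agents with $c$ connected components having vertex sets $V_{(1)},\dots,V_{(c)}$; so $G$ is block diagonal with blocks $G_{(1)},\dots,G_{(c)}$, $G_{(\ell)}$ being the adjacency matrix of component $\ell$. $\rho(G)$ is the spectral radius; $\beta\in(0,1)$, $\delta>0$, $\mu>0$; $[c]=\{1,\dots,c\}$; inequalities are entrywise; $\mathbf 1$ is the all-ones vector. Let $M^+:=((1+\beta)I-(\delta+\mu)G)^{-1}$, $M^-:=((1-\beta)I-(\delta-\mu)G)^{-1}$, $M_\Delta:=M^--M^+$, $b_\Delta:=M_\Delta\mathbf 1$. Pre-intervention prices are $p^{A0},p^{B0}\in\mathbb R^n_{\ge0}$, with $p^{A0}$ uniform in each component (common value $p^{A0}_{(\ell)}$ in component $\ell$); $p^{B0}_{(\ell)}$ denotes the restriction of $p^{B0}$ to $V_{(\ell)}$. The pre-intervention equilibrium efforts are $x^{A0}=\frac12((M^++M^-)p^{A0}+(M^+-M^-)p^{B0})$, $x^{B0}=\frac12((M^+-M^-)p^{A0}+(M^++M^-)p^{B0})$. Let $p^{\lim}:=M_\Delta^{-1}(M^++M^-)p^{B0}$ and $k_0:=\mathbf 1^\top(M^++M^-)^\top p^{B0}-2\tau^B$, with $\tau^B\ge0$ a tolerance on aggregate unsustainable effort. Component quantities. For $\ell\in[c]$ let $M^{\pm}_{(\ell)}:=((1\pm\beta)I-(\delta\pm\mu)G_{(\ell)})^{-1}$,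 $Q_{(\ell)}:=(1+\beta)(M^+_{(\ell)})^2+(1-\beta)(M^-_{(\ell)})^2$, $R_{(\ell)}:=(1-\beta)(M^-_{(\ell)})^2-(1+\beta)(M^+_{(\ell)})^2$, $q_{(\ell)}:=\mathbf 1^\top Q_{(\ell)}\mathbf 1$, $v_{(\ell)}:=2\,\mathbf 1^\top R_{(\ell)}p^{B0}_{(\ell)}$, $b_{\Delta(\ell)}:=\sum_{i\in V_{(\ell)}}b_{\Delta i}$ (all $b_{\Delta(\ell)}>0$ under the hypotheses). Problem. A component-wise uniform policy is a vector $p^A=(p^A_{(\ell)})_{\ell\in[c]}\in\mathbb R^c$, every agent of component $\ell$ receiving price $p^A_{(\ell)}$. Its welfare (up to the paper's constant factor $1/4$) is $$\phi(p^A)=\sum_{\ell=1}^c\Big(q_{(\ell)}(p^A_{(\ell)})^2-v_{(\ell)}p^A_{(\ell)}+(p^{B0}_{(\ell)})^\top Q_{(\ell)}p^{B0}_{(\ell)}\Big).$$ $\tilde p^{\max}\in\mathbb R^c$ is a vector of upper bounds with $\tilde p^{\max}_{(\ell)}\ge p^{A0}_{(\ell)}$. Problem $\widetilde{\boldsymbol P}$: maximize $\sum_\ell\big(q_{(\ell)}(p^A_{(\ell)})^2-v_{(\ell)}p^A_{(\ell)}\big)$ subject to $\sum_\ell b_{\Delta(\ell)}p^A_{(\ell)}\ge k_0$ and $p^{A0}_{(\ell)}\le p^A_{(\ell)}\le\tilde p^{\max}_{(\ell)}$ for all $\ell$. Convex relaxation (RP). Put $\tilde p_\ell:=b_{\Delta(\ell)}\big(p^A_{(\ell)}-\frac{v_{(\ell)}}{2q_{(\ell)}}\big)$,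 $\tilde p_{0\ell}:=b_{\Delta(\ell)}\big(p^{A0}_{(\ell)}-\frac{v_{(\ell)}}{2q_{(\ell)}}\big)$, $\tilde u_\ell:=b_{\Delta(\ell)}\big(\tilde p^{\max}_{(\ell)}-\frac{v_{(\ell)}}{2q_{(\ell)}}\big)$, $d_\ell:=-q_{(\ell)}/b_{\Delta(\ell)}^2$, $\tilde k_0:=k_0-\sum_\ell\frac{b_{\Delta(\ell)}v_{(\ell)}}{2q_{(\ell)}}$, and $$g_\ell^{**}(\tilde p_\ell):=\begin{cases}d_\ell\big((\tilde u_\ell+\tilde p_{0\ell})\tilde p_\ell-\tilde u_\ell\tilde p_{0\ell}\big)&\text{if }\tilde p_{0\ell}\le\tilde p_\ell\le\tilde u_\ell,\\ \infty&\text{otherwise.}\end{cases}$$ (RP): maximize $-\sum_\ell g_\ell^{**}(\tilde p_\ell)$ subject to $\sum_\ell\tilde p_\ell\ge\tilde k_0$. The relaxed objective, as a function of $p^A$, is $$\tilde\phi_{\mathrm{rel}}(p^A):=-\sum_\ell g_\ell^{**}(\tilde p_\ell)+\sum_\ell\Big((p^{B0}_{(\ell)})^\top Q_{(\ell)}p^{B0}_{(\ell)}-\frac{v_{(\ell)}^2}{4q_{(\ell)}}\Big).$$ Policies. With the components ordered as in the claim, let $S_L:=\{\ell\in[c]:p^{A0}_{(\ell)}+\tilde p^{\max}_{(\ell)}\le v_{(\ell)}/q_{(\ell)}\}$ (so $S_L=\{\ell',\ell'+1,\dots,c\}$) and $\ell':=\min S_L$ (with $\ell':=c+1$ if $S_L=\emptyset$).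 For $0\le\ell\le c$ let $p^{(\ell)}\in\mathbb R^c$ be given by $p^{(\ell)}_{(m)}:=\tilde p^{\max}_{(m)}$ for $1\le m\le\ell$ and $p^{(\ell)}_{(m)}:=p^{A0}_{(m)}$ for $\ell+1\le m\le c$. Let $\ell^*:=\min\{\ell\in S_L\cup\{\ell'-1\}:\sum_{m=1}^cb_{\Delta(m)}p^{(\ell)}_{(m)}\ge k_0\}$. Define $\bar p\in\mathbb R^c$ as follows: if $\ell^*=\ell'-1$, then $\bar p:=p^{(\ell'-1)}$; otherwise $\bar p_{(\ell)}:=p^{(\ell^* )}_{(\ell)}$ for $\ell\ne\ell^*$ and $$\bar p_{(\ell^* )}:=\frac{k_0-\sum_{m\ne\ell^*}b_{\Delta(m)}p^{(\ell^* )}_{(m)}}{b_{\Delta(\ell^* )}}.$$ *)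

theory Defs
  imports
    Complex_Main
    "HOL-Library.Extended_Real"
    "Jordan_Normal_Form.Spectral_Radius"
    "Jordan_Normal_Form.Gauss_Jordan_Elimination"
    "Jordan_Normal_Form.DL_Submatrix"
begin

(* Agents are numbered 0, ..., n - 1; components are numbered 1, ..., c.  The numbering of the
   agents within the n x n matrix is arbitrary: agents of one component need not be consecutive, and
   the diagonal block of a component is the principal submatrix on its vertex set. *)

record pricing_instance =
  agents :: nat                       (* n *)
  adj :: "real mat"                   (* G *)
  num_comps :: nat                    (* c *)
  verts :: "nat \<Rightarrow> nat set"           (* V_(l), for 1 <= l <= c *)
  beta :: real
  delta :: real
  mu :: real
  price0A :: "real vec"               (* p^{A0}, one entry per agent *)
  comp_price0A :: "nat \<Rightarrow> real"       (* common value of p^{A0} in component l *)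
  price0B :: "real vec"               (* p^{B0}, one entry per agent *)
  tol :: real                         (* tau^B *)
  pmax :: "nat \<Rightarrow> real"               (* upper bound for component l *)

definition adj_rel :: "real mat \<Rightarrow> (nat \<times> nat) set" where
  "adj_rel G = {(i, j). i < dim_row G \<and> j < dim_row G \<and> G $$ (i, j) = 1}"

definition connected_comps :: "real mat \<Rightarrow> nat set set" where
  "connected_comps G = {..<dim_row G} // (adj_rel G)\<^sup>*"

definition ones :: "nat \<Rightarrow> real vec" where
  "ones k = vec k (\<lambda>_. 1)"

(* Meaningful only for invertible A.  The matrices inverted below are invertible when
   max (|delta + mu| / (1 + beta)) (|delta - mu| / (1 - beta)) * spectral radius of G < 1 and
   mu < beta * delta. *)
definition inv_mat :: "real mat \<Rightarrow> real mat" where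
  "inv_mat A = the (mat_inverse A)"

definition Mplus_of :: "pricing_instance \<Rightarrow> real mat \<Rightarrow> real mat" where
  "Mplus_of N H = inv_mat ((1 + beta N) \<cdot>\<^sub>m 1\<^sub>m (dim_row H) - (delta N + mu N) \<cdot>\<^sub>m H)"

definition Mminus_of :: "pricing_instance \<Rightarrow> real mat \<Rightarrow> real mat" where
  "Mminus_of N H = inv_mat ((1 - beta N) \<cdot>\<^sub>m 1\<^sub>m (dim_row H) - (delta N - mu N) \<cdot>\<^sub>m H)"

definition Mplus :: "pricing_instance \<Rightarrow> real mat" where
  "Mplus N = Mplus_of N (adj N)"

definition Mminus :: "pricing_instance \<Rightarrow> real mat" where
  "Mminus N = Mminus_of N (adj N)"

definition Mdelta :: "pricing_instance \<Rightarrow> real mat" where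
  "Mdelta N = Mminus N - Mplus N"

definition bdelta :: "pricing_instance \<Rightarrow> real vec" where
  "bdelta N = Mdelta N *\<^sub>v ones (agents N)"

definition xA0 :: "pricing_instance \<Rightarrow> real vec" where
  "xA0 N = (1 / 2) \<cdot>\<^sub>v ((Mplus N + Mminus N) *\<^sub>v price0A N + (Mplus N - Mminus N) *\<^sub>v price0B N)"

definition xB0 :: "pricing_instance \<Rightarrow> real vec" where
  "xB0 N = (1 / 2) \<cdot>\<^sub>v ((Mplus N - Mminus N) *\<^sub>v price0A N + (Mplus N + Mminus N) *\<^sub>v price0B N)"

definition plim :: "pricing_instance \<Rightarrow> real vec" where
  "plim N = inv_mat (Mdelta N) *\<^sub>v ((Mplus N + Mminus N) *\<^sub>v price0B N)"

definition k0 :: "pricing_instance \<Rightarrow> real" where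
  "k0 N = ones (agents N) \<bullet> ((Mplus N + Mminus N)\<^sup>T *\<^sub>v price0B N) - 2 * tol N"

definition comp_adj :: "pricing_instance \<Rightarrow> nat \<Rightarrow> real mat" where
  "comp_adj N l = submatrix (adj N) (verts N l) (verts N l)"

(* The entries are listed in increasing order of agents, as in submatrix. *)
definition comp_price0B :: "pricing_instance \<Rightarrow> nat \<Rightarrow> real vec" where
  "comp_price0B N l = vec (card (verts N l)) (\<lambda>i. price0B N $ pick (verts N l) i)"

definition comp_Mplus :: "pricing_instance \<Rightarrow> nat \<Rightarrow> real mat" where
  "comp_Mplus N l = Mplus_of N (comp_adj N l)"

definition comp_Mminus :: "pricing_instance \<Rightarrow> nat \<Rightarrow> real mat" where
  "comp_Mminus N l = Mminus_of N (comp_adj N l)"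

definition comp_Q :: "pricing_instance \<Rightarrow> nat \<Rightarrow> real mat" where
  "comp_Q N l = (1 + beta N) \<cdot>\<^sub>m (comp_Mplus N l ^\<^sub>m 2) + (1 - beta N) \<cdot>\<^sub>m (comp_Mminus N l ^\<^sub>m 2)"

definition comp_R :: "pricing_instance \<Rightarrow> nat \<Rightarrow> real mat" where
  "comp_R N l = (1 - beta N) \<cdot>\<^sub>m (comp_Mminus N l ^\<^sub>m 2) - (1 + beta N) \<cdot>\<^sub>m (comp_Mplus N l ^\<^sub>m 2)"

definition comp_q :: "pricing_instance \<Rightarrow> nat \<Rightarrow> real" where
  "comp_q N l = ones (card (verts N l)) \<bullet> (comp_Q N l *\<^sub>v ones (card (verts N l)))"

definition comp_v :: "pricing_instance \<Rightarrow> nat \<Rightarrow> real" where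
  "comp_v N l = 2 * (ones (card (verts N l)) \<bullet> (comp_R N l *\<^sub>v comp_price0B N l))"

definition comp_b :: "pricing_instance \<Rightarrow> nat \<Rightarrow> real" where
  "comp_b N l = (\<Sum>i\<in>verts N l. bdelta N $ i)"

definition comp_const :: "pricing_instance \<Rightarrow> nat \<Rightarrow> real" where
  "comp_const N l = comp_price0B N l \<bullet> (comp_Q N l *\<^sub>v comp_price0B N l)"

definition comp_gamma :: "pricing_instance \<Rightarrow> nat \<Rightarrow> real" where
  "comp_gamma N l =
     comp_q N l / comp_b N l * (comp_price0A N l + pmax N l - comp_v N l / comp_q N l)"

(* A component-wise uniform policy is a function on {1..c}; its values elsewhere are irrelevant. *)

(* welfare, up to the constant factor 1/4 *)
definition welfare :: "pricing_instance \<Rightarrow> (nat \<Rightarrow> real) \<Rightarrow> real" where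
  "welfare N p =
     (\<Sum>l = 1..num_comps N. comp_q N l * (p l)\<^sup>2 - comp_v N l * p l + comp_const N l)"

definition P_objective :: "pricing_instance \<Rightarrow> (nat \<Rightarrow> real) \<Rightarrow> real" where
  "P_objective N p = (\<Sum>l = 1..num_comps N. comp_q N l * (p l)\<^sup>2 - comp_v N l * p l)"

definition P_feasible :: "pricing_instance \<Rightarrow> (nat \<Rightarrow> real) \<Rightarrow> bool" where
  "P_feasible N p \<longleftrightarrow>
     (\<Sum>l = 1..num_comps N. comp_b N l * p l) \<ge> k0 N \<and>
     (\<forall>l\<in>{1..num_comps N}. comp_price0A N l \<le> p l \<and> p l \<le> pmax N l)"

definition P_optimal :: "pricing_instance \<Rightarrow> (nat \<Rightarrow> real) \<Rightarrow> bool" where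
  "P_optimal N p \<longleftrightarrow> is_arg_max (P_objective N) (P_feasible N) p"

definition shifted :: "pricing_instance \<Rightarrow> (nat \<Rightarrow> real) \<Rightarrow> nat \<Rightarrow> real" where
  "shifted N p l = comp_b N l * (p l - comp_v N l / (2 * comp_q N l))"

definition comp_d :: "pricing_instance \<Rightarrow> nat \<Rightarrow> real" where
  "comp_d N l = - comp_q N l / (comp_b N l)\<^sup>2"

definition shifted_k0 :: "pricing_instance \<Rightarrow> real" where
  "shifted_k0 N = k0 N - (\<Sum>l = 1..num_comps N. comp_b N l * comp_v N l / (2 * comp_q N l))"

(* convex envelope of x |-> d x^2 on the interval from the shifted lower to the shifted upper bound *)
definition gconv :: "pricing_instance \<Rightarrow> nat \<Rightarrow> real \<Rightarrow> ereal" where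
  "gconv N l x =
     (let lo = shifted N (comp_price0A N) l; u = shifted N (pmax N) l
      in if lo \<le> x \<and> x \<le> u then ereal (comp_d N l * ((u + lo) * x - u * lo)) else \<infinity>)"

(* The relaxation (RP) is a problem in the shifted variables y = shifted N p. *)
definition RP_objective :: "pricing_instance \<Rightarrow> (nat \<Rightarrow> real) \<Rightarrow> ereal" where
  "RP_objective N y = - (\<Sum>l = 1..num_comps N. gconv N l (y l))"

definition RP_feasible :: "pricing_instance \<Rightarrow> (nat \<Rightarrow> real) \<Rightarrow> bool" where
  "RP_feasible N y \<longleftrightarrow> (\<Sum>l = 1..num_comps N. y l) \<ge> shifted_k0 N"

definition RP_optimal :: "pricing_instance \<Rightarrow> (nat \<Rightarrow> real) \<Rightarrow> bool" where
  "RP_optimal N y \<longleftrightarrow> is_arg_max (RP_objective N) (RP_feasible N) y"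

definition relaxed_welfare :: "pricing_instance \<Rightarrow> (nat \<Rightarrow> real) \<Rightarrow> ereal" where
  "relaxed_welfare N p =
     RP_objective N (shifted N p) +
     ereal (\<Sum>l = 1..num_comps N. comp_const N l - (comp_v N l)\<^sup>2 / (4 * comp_q N l))"

definition S_L :: "pricing_instance \<Rightarrow> nat set" where
  "S_L N = {l \<in> {1..num_comps N}. comp_price0A N l + pmax N l \<le> comp_v N l / comp_q N l}"

definition ell' :: "pricing_instance \<Rightarrow> nat" where
  "ell' N = (if S_L N = {} then num_comps N + 1 else Min (S_L N))"

definition threshold_policy :: "pricing_instance \<Rightarrow> nat \<Rightarrow> nat \<Rightarrow> real" where
  "threshold_policy N l m = (if m \<le> l then pmax N m else comp_price0A N m)"

definition ell_star :: "pricing_instance \<Rightarrow> nat" where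
  "ell_star N =
     Min {l \<in> S_L N \<union> {ell' N - 1}.
            (\<Sum>m = 1..num_comps N. comp_b N m * threshold_policy N l m) \<ge> k0 N}"

definition pbar :: "pricing_instance \<Rightarrow> nat \<Rightarrow> real" where
  "pbar N =
     (if ell_star N = ell' N - 1 then threshold_policy N (ell' N - 1)
      else (threshold_policy N (ell_star N))
             (ell_star N :=
                (k0 N - (\<Sum>m\<in>{1..num_comps N} - {ell_star N}.
                            comp_b N m * threshold_policy N (ell_star N) m))
                / comp_b N (ell_star N)))"

end

theory Submission
  imports Defs
begin

text \<open>
  Completing the square in each component turns welfare into a sum of convex parabolas in the shifted
  prices \<open>shifted N p l\<close>. On the interval allowed for component \<open>l\<close>, the relaxation replaces the
  parabola by its secant, whose slope is \<open>comp_gamma N l\<close>. A convex function lies below its secant and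
  meets it at the two endpoints, so the relaxed objective bounds welfare from above and agrees with it
  at every policy that puts each component at one of its two bounds.

  What remains of (RP) is linear: maximize \<open>\<Sum>l. comp_gamma N l * y l\<close> over a box under a single lower
  bound on \<open>\<Sum>l. y l\<close>. This is a fractional knapsack with value densities \<open>comp_gamma N l\<close>, and the
  greedy solution is optimal: put every component of positive density at its upper bound; if the
  constraint is still violated, raise the others in descending order of density, the last one only as
  far as the constraint demands. This is \<open>pbar\<close>, and \<open>pbar_maximizes_linear\<close> certifies its optimality by
  a Lagrange multiplier. Hence \<open>shifted N (pbar N)\<close> solves (RP) and its relaxed value bounds the welfare
  of every feasible policy. If the component \<open>ell_star\<close> is not raised in part, then \<open>pbar\<close> is at a
  bound in every component, the two objectives agree at it, and so it also maximizes welfare.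

  All of this rests on \<open>comp_q N l > 0\<close> (convexity) and \<open>comp_b N l > 0\<close> (the orientation of the
  constraint), which is where the network enters. They follow from an inverse-positivity principle: if
  \<open>G\<close> is nonnegative and \<open>t / s\<close> times its spectral radius is less than 1, then \<open>(s I - t G) w \<ge> 0\<close>
  implies \<open>w \<ge> 0\<close> (\<open>monotone_mat_resolvent\<close>). The principle passes to principal submatrices, so the
  matrices of the components are invertible too, and \<open>comp_q N l\<close> is a positive combination of squared
  norms. Applied to the difference of \<open>Mminus N\<close> and \<open>Mplus N\<close> at the all-ones vector, it shows that
  every entry of \<open>bdelta N\<close> is positive (\<open>resolvent_difference_mult_ones_pos\<close>); here the hypothesis
  \<open>mu < beta delta\<close> enters, which makes \<open>Mminus N\<close> the larger of the two resolvents.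
\<close>

section \<open>Monotone matrices and resolvents of nonnegative matrices\<close>

text \<open>
  Monotonicity in the sense of Collatz. For a square matrix it is equivalent to invertibility with
  an entrywise nonnegative inverse, but this form speaks of solutions of inequalities only: it is
  available before any inverse is, and it passes to principal submatrices.
\<close>

definition monotone_mat :: "real mat \<Rightarrow> bool" where
  "monotone_mat A \<longleftrightarrow> (\<forall>w\<in>carrier_vec (dim_col A).
     (\<forall>i<dim_row A. 0 \<le> (A *\<^sub>v w) $ i) \<longrightarrow> (\<forall>i<dim_col A. 0 \<le> w $ i))"

lemma mult_mat_vec_sum:
  assumes "A \<in> carrier_mat n m" "w \<in> carrier_vec m" "i < n"
  shows "(A *\<^sub>v w) $ i = (\<Sum>j<m. A $$ (i, j) * w $ j)"
  using assms by (auto simp: scalar_prod_def lessThan_atLeast0 intro!: sum.cong)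

lemma shifted_scaled_mult_vec:
  fixes H :: "real mat"
  assumes H: "H \<in> carrier_mat n n" and w: "w \<in> carrier_vec n" and i: "i < n"
  shows "((s \<cdot>\<^sub>m 1\<^sub>m n - t \<cdot>\<^sub>m H) *\<^sub>v w) $ i = s * w $ i - t * (\<Sum>j<n. H $$ (i, j) * w $ j)"
proof -
  have "((s \<cdot>\<^sub>m 1\<^sub>m n - t \<cdot>\<^sub>m H) *\<^sub>v w) $ i
      = (\<Sum>j<n. (s \<cdot>\<^sub>m 1\<^sub>m n - t \<cdot>\<^sub>m H) $$ (i, j) * w $ j)"
    by (rule mult_mat_vec_sum) (use H w i in auto)
  also have "\<dots> = (\<Sum>j<n. (if j = i then s * w $ j else 0) - t * (H $$ (i, j) * w $ j))"
    using H i by (intro sum.cong) (auto simp: algebra_simps)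
  also have "\<dots> = s * w $ i - t * (\<Sum>j<n. H $$ (i, j) * w $ j)"
    using i by (simp add: sum_subtractf sum_distrib_left)
  finally show ?thesis .
qed

lemma smult_mat_mult_vec:
  fixes A :: "'a :: comm_semiring_0 mat"
  assumes A: "A \<in> carrier_mat n m" and v: "v \<in> carrier_vec m"
  shows "(a \<cdot>\<^sub>m A) *\<^sub>v v = a \<cdot>\<^sub>v (A *\<^sub>v v)"
  by (rule eq_vecI)
    (use A v in \<open>auto simp: scalar_prod_def sum_distrib_left mult.assoc intro!: sum.cong\<close>)

lemma smult_pow_mat:
  fixes A :: "'a :: comm_semiring_1 mat"
  assumes A: "A \<in> carrier_mat n n"
  shows "(a \<cdot>\<^sub>m A) ^\<^sub>m k = a ^ k \<cdot>\<^sub>m (A ^\<^sub>m k)"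
proof (induction k)
  case 0
  show ?case by (rule eq_matI) (use A in auto)
next
  case (Suc k)
  have Ak: "A ^\<^sub>m k \<in> carrier_mat n n" using A by simp
  have "(a \<cdot>\<^sub>m A) ^\<^sub>m Suc k = (a ^ k \<cdot>\<^sub>m (A ^\<^sub>m k)) * (a \<cdot>\<^sub>m A)"
    using Suc by simp
  also have "\<dots> = a ^ k \<cdot>\<^sub>m (a \<cdot>\<^sub>m (A ^\<^sub>m k * A))"
    using mult_smult_assoc_mat[of "A ^\<^sub>m k" n n "a \<cdot>\<^sub>m A" n "a ^ k"]
      mult_smult_distrib[OF Ak A, of a] A Ak by simp
  also have "\<dots> = a ^ Suc k \<cdot>\<^sub>m (A ^\<^sub>m Suc k)"
    by (rule eq_matI) (use A Ak in \<open>auto simp: mult_ac\<close>)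
  finally show ?case .
qed

lemma spectral_radius_nonneg:
  assumes "A \<in> carrier_mat n n" "0 < n"
  shows "0 \<le> spectral_radius A"
  using spectral_radius_mem_max(1)[OF assms] by auto

lemma spectral_radius_smult_le:
  assumes A: "A \<in> carrier_mat n n" and n: "0 < n" and a: "0 < a"
  shows "spectral_radius (complex_of_real a \<cdot>\<^sub>m A) \<le> a * spectral_radius A"
proof -
  let ?B = "complex_of_real a \<cdot>\<^sub>m A"
  have B: "?B \<in> carrier_mat n n" using A by simp
  obtain ev where ev: "eigenvalue ?B ev" and sr: "spectral_radius ?B = norm ev"
    using spectral_radius_mem_max(1)[OF B n] unfolding spectrum_def by auto
  then obtain v where v: "v \<in> carrier_vec n" "v \<noteq> 0\<^sub>v n" "?B *\<^sub>v v = ev \<cdot>\<^sub>v v"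
    using A unfolding eigenvalue_def eigenvector_def by auto
  have "A *\<^sub>v v = (ev / complex_of_real a) \<cdot>\<^sub>v v"
  proof (rule eq_vecI)
    fix i assume "i < dim_vec ((ev / complex_of_real a) \<cdot>\<^sub>v v)"
    then have i: "i < n" using v by simp
    have "(?B *\<^sub>v v) $ i = complex_of_real a * (A *\<^sub>v v) $ i"
      unfolding smult_mat_mult_vec[OF A v(1)] using A i by simp
    moreover have "(?B *\<^sub>v v) $ i = ev * v $ i" using v i by simp
    ultimately show "(A *\<^sub>v v) $ i = ((ev / complex_of_real a) \<cdot>\<^sub>v v) $ i"
      using v i a by (simp add: field_simps del: index_mult_mat_vec)
  qed (use A v in simp)
  then have "eigenvalue A (ev / complex_of_real a)"
    using A v unfolding eigenvalue_def eigenvector_def by auto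
  then have "norm (ev / complex_of_real a) \<le> spectral_radius A"
    by (intro spectral_radius_mem_max(2)[OF A n]) (auto simp: spectrum_def)
  then show ?thesis using sr a by (simp add: norm_divide field_simps)
qed

text \<open>
  The strict inequality leaves room for a slightly larger factor \<open>a + e\<close> for which
  \<open>(a + e) A\<close> still has spectral radius below 1 and hence bounded powers; the remaining
  factor \<open>(a / (a + e))^k\<close> then decays geometrically.
\<close>

lemma scaled_powers_tendsto_zero:
  fixes A :: "complex mat"
  assumes A: "A \<in> carrier_mat n n" and a: "0 \<le> a" and lt: "a * spectral_radius A < 1"
    and i: "i < n" and j: "j < n"
  shows "(\<lambda>k. a ^ k * norm ((A ^\<^sub>m k) $$ (i, j))) \<longlonglongrightarrow> 0"
proof -
  let ?r = "spectral_radius A"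
  have n: "0 < n" using i by simp
  have r: "0 \<le> ?r" by (rule spectral_radius_nonneg[OF A n])
  \<comment> \<open>Half of the slack \<open>1 - a r\<close>; the summand 1 in the denominator covers a nilpotent
    matrix, whose spectral radius vanishes.\<close>
  define e where "e = (1 - a * ?r) / 2 / (1 + ?r)"
  have e: "0 < e" using lt r by (simp add: e_def)
  have "e * (1 + ?r) = (1 - a * ?r) / 2"
  proof -
    have "1 + ?r \<noteq> 0" using r by linarith
    then show ?thesis by (metis e_def nonzero_divide_eq_eq)
  qed
  then have er: "(a + e) * ?r < 1" using e lt by (simp add: algebra_simps)
  let ?B = "complex_of_real (a + e) \<cdot>\<^sub>m A"
  have "spectral_radius ?B \<le> (a + e) * ?r"
    by (rule spectral_radius_smult_le[OF A n]) (use a e in simp)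
  then have "spectral_radius ?B < 1" using er by simp
  from spectral_radius_jnf_norm_bound_less_1_upper_triangular[OF _ this, of n] A
  obtain C where C: "norm_bound (?B ^\<^sub>m k) C" for k by auto
  have bound: "a ^ k * norm ((A ^\<^sub>m k) $$ (i, j)) \<le> C * (a / (a + e)) ^ k" for k
  proof -
    have "norm ((?B ^\<^sub>m k) $$ (i, j)) \<le> C"
      using C[of k] A i j unfolding norm_bound_def by auto
    moreover have "(?B ^\<^sub>m k) $$ (i, j) = complex_of_real (a + e) ^ k * (A ^\<^sub>m k) $$ (i, j)"
      using smult_pow_mat[OF A, of "complex_of_real (a + e)" k] A i j by simp
    ultimately have "(a + e) ^ k * norm ((A ^\<^sub>m k) $$ (i, j)) \<le> C"
      using a e by (simp add: norm_mult norm_power del: of_real_add)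
    then have "(a / (a + e)) ^ k * ((a + e) ^ k * norm ((A ^\<^sub>m k) $$ (i, j)))
        \<le> (a / (a + e)) ^ k * C"
      using a e by (intro mult_left_mono) auto
    then show ?thesis using a e by (simp add: power_divide mult.commute)
  qed
  have "(\<lambda>k. (a / (a + e)) ^ k) \<longlonglongrightarrow> 0"
    using a e by (intro LIMSEQ_realpow_zero) auto
  then have lim: "(\<lambda>k. C * (a / (a + e)) ^ k) \<longlonglongrightarrow> 0"
    using tendsto_mult_right_zero by blast
  show ?thesis
    by (rule real_tendsto_sandwich[OF _ _ tendsto_const lim]) (use bound a in auto)
qed

lemma pow_mat_nonneg:
  fixes G :: "real mat"
  assumes G: "G \<in> carrier_mat n n" and nn: "\<And>i j. i < n \<Longrightarrow> j < n \<Longrightarrow> 0 \<le> G $$ (i, j)"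
    and ij: "i < n" "j < n"
  shows "0 \<le> (G ^\<^sub>m k) $$ (i, j)"
  using ij
proof (induction k arbitrary: j)
  case 0
  then show ?case using G by simp
next
  case (Suc k)
  then show ?case using G nn by (auto simp: scalar_prod_def intro!: sum_nonneg)
qed

text \<open>
  With \<open>a = t / s\<close> the premise reads \<open>a G w \<le> w\<close>. As \<open>G\<close> is nonnegative this can be
  iterated to \<open>a^k G^k w \<le> w\<close>, and the left-hand side tends to 0.
\<close>

lemma monotone_mat_resolvent:
  fixes G :: "real mat"
  assumes G: "G \<in> carrier_mat n n" and nn: "\<And>i j. i < n \<Longrightarrow> j < n \<Longrightarrow> 0 \<le> G $$ (i, j)"
    and s: "0 < s" and t: "0 \<le> t"
    and lt: "t / s * spectral_radius (map_mat complex_of_real G) < 1"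
  shows "monotone_mat (s \<cdot>\<^sub>m 1\<^sub>m n - t \<cdot>\<^sub>m G)"
  unfolding monotone_mat_def
proof (intro ballI impI allI)
  let ?A = "s \<cdot>\<^sub>m 1\<^sub>m n - t \<cdot>\<^sub>m G"
  fix w i
  assume w: "w \<in> carrier_vec (dim_col ?A)" and pos: "\<forall>i<dim_row ?A. 0 \<le> (?A *\<^sub>v w) $ i"
    and i: "i < dim_col ?A"
  define a where "a = t / s"
  have a: "0 \<le> a" using s t by (simp add: a_def)
  have w: "w \<in> carrier_vec n" and i: "i < n" using w i G by auto
  have sub: "a * (\<Sum>j<n. G $$ (l, j) * w $ j) \<le> w $ l" if "l < n" for l
    using pos[rule_format, of l] that shifted_scaled_mult_vec[OF G w that, of s t] G s
    by (simp add: a_def field_simps)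
  have iterate: "a ^ k * (\<Sum>j<n. (G ^\<^sub>m k) $$ (i, j) * w $ j) \<le> w $ i" for k
  proof (induction k)
    case 0
    have "(\<Sum>j<n. (G ^\<^sub>m 0) $$ (i, j) * w $ j) = (\<Sum>j<n. if j = i then w $ j else 0)"
      using G i by (intro sum.cong) auto
    then show ?case using i by simp
  next
    case (Suc k)
    have Gk: "G ^\<^sub>m k \<in> carrier_mat n n" and Gw: "G *\<^sub>v w \<in> carrier_vec n"
      using G w by auto
    have "(\<Sum>j<n. (G ^\<^sub>m Suc k) $$ (i, j) * w $ j) = ((G ^\<^sub>m k * G) *\<^sub>v w) $ i"
      using mult_mat_vec_sum[OF mult_carrier_mat[OF Gk G] w i]
      by (simp del: index_mult_mat index_mult_mat_vec)
    also have "\<dots> = (G ^\<^sub>m k *\<^sub>v (G *\<^sub>v w)) $ i"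
      using assoc_mult_mat_vec[OF Gk G w] by simp
    also have "\<dots> = (\<Sum>l<n. (G ^\<^sub>m k) $$ (i, l) * (\<Sum>j<n. G $$ (l, j) * w $ j))"
      unfolding mult_mat_vec_sum[OF Gk Gw i] by (intro sum.cong) (use mult_mat_vec_sum[OF G w] in auto)
    finally have "a ^ Suc k * (\<Sum>j<n. (G ^\<^sub>m Suc k) $$ (i, j) * w $ j)
        = a ^ k * (\<Sum>l<n. (G ^\<^sub>m k) $$ (i, l) * (a * (\<Sum>j<n. G $$ (l, j) * w $ j)))"
      by (simp add: sum_distrib_left mult_ac)
    also have "\<dots> \<le> a ^ k * (\<Sum>l<n. (G ^\<^sub>m k) $$ (i, l) * w $ l)"
      using a i by (intro mult_left_mono sum_mono sub pow_mat_nonneg[OF G nn]) auto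
    finally show ?case using Suc by simp
  qed
  have entry: "(\<lambda>k. a ^ k * (G ^\<^sub>m k) $$ (i, j)) \<longlonglongrightarrow> 0" if j: "j < n" for j
  proof -
    have hom: "map_mat complex_of_real G ^\<^sub>m k = map_mat complex_of_real (G ^\<^sub>m k)" for k
      by (rule of_real_hom.mat_hom_pow[OF G, symmetric])
    have "norm ((map_mat complex_of_real G ^\<^sub>m k) $$ (i, j)) = (G ^\<^sub>m k) $$ (i, j)" for k
      unfolding hom using G i j pow_mat_nonneg[OF G nn i j, of k] by simp
    then show ?thesis
      using scaled_powers_tendsto_zero[OF _ a lt[folded a_def] i j] G by simp
  qed
  have "(\<lambda>k. \<Sum>j<n. a ^ k * (G ^\<^sub>m k) $$ (i, j) * w $ j) \<longlonglongrightarrow> (\<Sum>j<n. 0 * w $ j)"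
    by (intro tendsto_sum tendsto_mult entry tendsto_const) simp
  then have "(\<lambda>k. a ^ k * (\<Sum>j<n. (G ^\<^sub>m k) $$ (i, j) * w $ j)) \<longlonglongrightarrow> 0"
    by (simp add: sum_distrib_left mult_ac)
  then show "0 \<le> w $ i"
    by (rule LIMSEQ_le_const2) (use iterate in auto)
qed

text \<open>
  Comparison of \<open>w\<close> with the constant vector \<open>e / s\<close>: the matrix maps the latter to a vector
  that is at most \<open>e\<close>, because \<open>t H\<close> only subtracts.
\<close>

lemma monotone_mat_mult_vec_lower_bound:
  fixes H :: "real mat"
  assumes H: "H \<in> carrier_mat n n" and nn: "\<And>i j. i < n \<Longrightarrow> j < n \<Longrightarrow> 0 \<le> H $$ (i, j)"
    and s: "0 < s" and t: "0 \<le> t" and mono: "monotone_mat (s \<cdot>\<^sub>m 1\<^sub>m n - t \<cdot>\<^sub>m H)"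
    and e: "0 \<le> e" and w: "w \<in> carrier_vec n"
    and ge: "\<And>i. i < n \<Longrightarrow> e \<le> ((s \<cdot>\<^sub>m 1\<^sub>m n - t \<cdot>\<^sub>m H) *\<^sub>v w) $ i"
    and i: "i < n"
  shows "e / s \<le> w $ i"
proof -
  define w' where "w' = vec n (\<lambda>i. w $ i - e / s)"
  have w': "w' \<in> carrier_vec n" by (simp add: w'_def)
  have "0 \<le> ((s \<cdot>\<^sub>m 1\<^sub>m n - t \<cdot>\<^sub>m H) *\<^sub>v w') $ l" if l: "l < n" for l
  proof -
    have "0 \<le> t * (\<Sum>j<n. H $$ (l, j) * (e / s))"
      using nn l t e s by (intro mult_nonneg_nonneg sum_nonneg) auto
    moreover have "(\<Sum>j<n. H $$ (l, j) * w' $ j)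
        = (\<Sum>j<n. H $$ (l, j) * w $ j) - (\<Sum>j<n. H $$ (l, j) * (e / s))"
      by (simp add: w'_def right_diff_distrib sum_subtractf)
    moreover have "s * w' $ l = s * w $ l - e"
      using l s by (simp add: w'_def right_diff_distrib)
    ultimately show ?thesis
      using ge[OF l] unfolding shifted_scaled_mult_vec[OF H w l] shifted_scaled_mult_vec[OF H w' l]
      by (simp add: right_diff_distrib)
  qed
  then have "0 \<le> w' $ i"
    using mono w' i H unfolding monotone_mat_def by auto
  then show ?thesis using i by (simp add: w'_def)
qed

lemma submatrix_carrier:
  assumes "G \<in> carrier_mat n n" and "V \<subseteq> {..<n}"
  shows "submatrix G V V \<in> carrier_mat (card V) (card V)"
proof -
  have "{i. i < n \<and> i \<in> V} = V" using assms by auto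
  then show ?thesis using assms by (auto simp: dim_submatrix)
qed

lemma bij_betw_pick:
  assumes "finite V"
  shows "bij_betw (pick V) {..<card V} V"
proof -
  have "inj_on (pick V) {..<card V}"
    by (rule linorder_inj_onI') (use pick_mono in \<open>force\<close>)
  moreover have "pick V ` {..<card V} \<subseteq> V" using pick_in_set by auto
  ultimately show ?thesis
    unfolding bij_betw_def using assms by (metis card_image card_lessThan card_subset_eq)
qed

text \<open>
  The negative part \<open>min w 0\<close> of a vector \<open>w\<close> with \<open>t H w \<le> s w\<close> satisfies the same inequality,
  since \<open>H\<close> is nonnegative. Extended by zero outside \<open>V\<close> it satisfies it for all of \<open>G\<close>: in the new
  rows the left-hand side is nonpositive and the right-hand side is zero. So monotonicity of
  the full matrix makes the extension, and with it the negative part of \<open>w\<close>, vanish.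
\<close>

lemma monotone_mat_principal_submatrix:
  fixes G :: "real mat"
  assumes G: "G \<in> carrier_mat n n" and nn: "\<And>i j. i < n \<Longrightarrow> j < n \<Longrightarrow> 0 \<le> G $$ (i, j)"
    and V: "V \<subseteq> {..<n}" and s: "0 < s" and t: "0 \<le> t"
    and mono: "monotone_mat (s \<cdot>\<^sub>m 1\<^sub>m n - t \<cdot>\<^sub>m G)"
  shows "monotone_mat (s \<cdot>\<^sub>m 1\<^sub>m (card V) - t \<cdot>\<^sub>m submatrix G V V)"
  unfolding monotone_mat_def
proof (intro ballI impI allI)
  let ?m = "card V" and ?H = "submatrix G V V"
  let ?A = "s \<cdot>\<^sub>m 1\<^sub>m ?m - t \<cdot>\<^sub>m ?H"
  have H: "?H \<in> carrier_mat ?m ?m" by (rule submatrix_carrier[OF G V])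
  fix w i
  assume w: "w \<in> carrier_vec (dim_col ?A)" and pos: "\<forall>i<dim_row ?A. 0 \<le> (?A *\<^sub>v w) $ i"
    and i: "i < dim_col ?A"
  have w: "w \<in> carrier_vec ?m" and i: "i < ?m" using w i H by auto
  have fin: "finite V" using V finite_subset by blast
  note bij = bij_betw_pick[OF fin]
  \<comment> \<open>The inverse of the enumeration \<open>pick V\<close>.\<close>
  define pos_of where "pos_of = (\<lambda>i. card {a \<in> V. a < i})"
  have pos_of_pick: "pos_of (pick V k) = k" if "k < ?m" for k
    using that card_pick by (simp add: pos_of_def)
  have pick_pos_of: "pick V (pos_of l) = l" if "l \<in> V" for l
    using that pick_card_in_set by (simp add: pos_of_def)
  have pos_of_less: "pos_of l < ?m" if "l \<in> V" for l
    using that bij pos_of_pick unfolding bij_betw_def by (metis imageE lessThan_iff)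
  define u where "u = vec n (\<lambda>i. if i \<in> V then min (w $ pos_of i) 0 else 0)"
  have u: "u \<in> carrier_vec n" by (simp add: u_def)
  have u_nonpos: "u $ j \<le> 0" if "j < n" for j using that by (simp add: u_def)
  have "0 \<le> ((s \<cdot>\<^sub>m 1\<^sub>m n - t \<cdot>\<^sub>m G) *\<^sub>v u) $ l" if l: "l < n" for l
  proof -
    have Gu: "(\<Sum>j<n. G $$ (l, j) * u $ j) \<le> 0"
      using nn l u_nonpos by (intro sum_nonpos mult_nonneg_nonpos) auto
    have "t * (\<Sum>j<n. G $$ (l, j) * u $ j) \<le> s * u $ l"
    proof (cases "l \<in> V \<and> w $ pos_of l < 0")
      case False
      then have "u $ l = 0" using l by (auto simp: u_def)
      then show ?thesis using Gu t by (simp add: mult_nonneg_nonpos)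
    next
      case True
      let ?k = "pos_of l"
      have k: "?k < ?m" "pick V ?k = l" using True pos_of_less pick_pos_of by auto
      have "(\<Sum>j<n. G $$ (l, j) * u $ j) = (\<Sum>j\<in>V. G $$ (l, j) * u $ j)"
        using V by (intro sum.mono_neutral_right) (auto simp: u_def)
      also have "\<dots> = (\<Sum>j<?m. G $$ (l, pick V j) * u $ pick V j)"
        by (rule sum.reindex_bij_betw[OF bij, symmetric])
      also have "\<dots> \<le> (\<Sum>j<?m. ?H $$ (?k, j) * w $ j)"
      proof (rule sum_mono)
        fix j assume j: "j \<in> {..<?m}"
        have sub: "{i. i < dim_row G \<and> i \<in> V} = V" "{i. i < dim_col G \<and> i \<in> V} = V"
          using V G by auto
        have inV: "pick V j \<in> V" using j pick_in_set by auto
        then have jn: "pick V j < n" using V by auto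
        have "?H $$ (?k, j) = G $$ (l, pick V j)"
          using submatrix_index[of ?k G V j V] k j unfolding sub by simp
        moreover have "u $ pick V j \<le> w $ j"
          using inV jn j pos_of_pick by (simp add: u_def)
        ultimately show "G $$ (l, pick V j) * u $ pick V j \<le> ?H $$ (?k, j) * w $ j"
          using nn[OF l jn] by (simp add: mult_left_mono)
      qed
      finally have "t * (\<Sum>j<n. G $$ (l, j) * u $ j) \<le> t * (\<Sum>j<?m. ?H $$ (?k, j) * w $ j)"
        using t by (rule mult_left_mono)
      also have "\<dots> \<le> s * w $ ?k"
        using pos[rule_format, of ?k] k shifted_scaled_mult_vec[OF H w k(1), of s t] H by simp
      also have "\<dots> = s * u $ l" using True l by (simp add: u_def)
      finally show ?thesis .
    qed
    then show ?thesis unfolding shifted_scaled_mult_vec[OF G u l] by simp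
  qed
  then have "\<forall>l<n. 0 \<le> u $ l"
    using mono u G unfolding monotone_mat_def by auto
  moreover have "pick V i \<in> V" "pick V i < n" using i pick_in_set V by auto
  ultimately have "0 \<le> u $ pick V i" by simp
  then show "0 \<le> w $ i"
    using \<open>pick V i \<in> V\<close> \<open>pick V i < n\<close> i pos_of_pick by (simp add: u_def)
qed

text \<open>
  A vector in the kernel of a monotone matrix and its negative are both nonnegative, so the kernel
  is trivial.
\<close>

lemma inv_mat_inverts:
  fixes A :: "real mat"
  assumes A: "A \<in> carrier_mat n n" and mono: "monotone_mat A"
  shows "A * inv_mat A = 1\<^sub>m n" "inv_mat A * A = 1\<^sub>m n" "inv_mat A \<in> carrier_mat n n"
proof -
  have "det A \<noteq> 0"
  proof
    assume "det A = 0"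
    then obtain v where v: "v \<in> carrier_vec n" "v \<noteq> 0\<^sub>v n" "A *\<^sub>v v = 0\<^sub>v n"
      using det_0_iff_vec_prod_zero_field[OF A] by auto
    have "(A *\<^sub>v v) $ i = 0" "(A *\<^sub>v (- v)) $ i = 0" if "i < n" for i
    proof -
      show Av: "(A *\<^sub>v v) $ i = 0" using v that by simp
      have "row A i \<bullet> (- v) = - (row A i \<bullet> v)" using A v that by simp
      then show "(A *\<^sub>v (- v)) $ i = 0" using A Av that by simp
    qed
    then have "\<forall>i<n. 0 \<le> (- v) $ i" "\<forall>i<n. 0 \<le> v $ i"
      using mono[unfolded monotone_mat_def, rule_format, of "- v"]
        mono[unfolded monotone_mat_def, rule_format, of v] A v by auto
    then have "v = 0\<^sub>v n" using v by (intro eq_vecI) (auto intro: antisym)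
    then show False using v by simp
  qed
  then have "A \<in> Units (ring_mat TYPE(real) n ())" by (rule det_non_zero_imp_unit[OF A])
  then obtain B where B: "mat_inverse A = Some B"
    using mat_inverse(1)[OF A, where b = "()"] by (cases "mat_inverse A") auto
  show "A * inv_mat A = 1\<^sub>m n" "inv_mat A * A = 1\<^sub>m n" "inv_mat A \<in> carrier_mat n n"
    using mat_inverse(2)[OF A B] B by (auto simp: inv_mat_def)
qed

lemma inv_mat_mult_self:
  fixes A :: "real mat"
  assumes A: "A \<in> carrier_mat n n" and mono: "monotone_mat A" and w: "w \<in> carrier_vec n"
  shows "A *\<^sub>v (inv_mat A *\<^sub>v w) = w"
  using inv_mat_inverts[OF A mono] A w by (metis assoc_mult_mat_vec one_mult_mat_vec)

lemma inv_mat_symmetric: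
  fixes A :: "real mat"
  assumes A: "A \<in> carrier_mat n n" and mono: "monotone_mat A" and sym: "A\<^sup>T = A"
  shows "(inv_mat A)\<^sup>T = inv_mat A"
proof -
  let ?M = "inv_mat A"
  note inv = inv_mat_inverts[OF A mono]
  have MT: "?M\<^sup>T \<in> carrier_mat n n" using inv by simp
  have "?M\<^sup>T * A = (A * ?M)\<^sup>T"
    using transpose_mult[OF A inv(3)] sym by simp
  then have "?M\<^sup>T * A = 1\<^sub>m n" using inv by simp
  then have "?M\<^sup>T * (A * ?M) = ?M"
    using assoc_mult_mat[OF MT A inv(3)] inv by simp
  then show ?thesis using inv MT by simp
qed

text \<open>
  By symmetry the quadratic form is the square of the Euclidean norm of \<open>inv_mat A *\<^sub>v x\<close>. This is
  what makes the quadratic welfare coefficients positive.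
\<close>

lemma square_quadratic_form_pos:
  fixes A :: "real mat"
  assumes A: "A \<in> carrier_mat n n" and mono: "monotone_mat A" and sym: "A\<^sup>T = A"
    and x: "x \<in> carrier_vec n" "x \<noteq> 0\<^sub>v n"
  shows "0 < x \<bullet> (inv_mat A ^\<^sub>m 2 *\<^sub>v x)"
proof -
  let ?M = "inv_mat A"
  note inv = inv_mat_inverts[OF A mono]
  define y where "y = ?M *\<^sub>v x"
  have y: "y \<in> carrier_vec n" using inv x by (simp add: y_def)
  have "?M ^\<^sub>m 2 = ?M * ?M" using inv by (simp add: numeral_2_eq_2)
  then have "?M ^\<^sub>m 2 *\<^sub>v x = ?M *\<^sub>v y"
    using inv x by (simp add: y_def)
  then have "x \<bullet> (?M ^\<^sub>m 2 *\<^sub>v x) = (?M\<^sup>T *\<^sub>v x) \<bullet> y"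
    using transpose_vec_mult_scalar[OF inv(3) y x(1)] by simp
  also have "\<dots> = y \<bullet> y" using inv_mat_symmetric[OF A mono sym] by (simp add: y_def)
  finally have eq: "x \<bullet> (?M ^\<^sub>m 2 *\<^sub>v x) = y \<bullet> y" .
  have "y \<noteq> 0\<^sub>v n"
  proof
    assume "y = 0\<^sub>v n"
    then have "x = A *\<^sub>v 0\<^sub>v n"
      using inv_mat_mult_self[OF A mono x(1)] by (simp add: y_def)
    then show False using x A by (auto simp: scalar_prod_def)
  qed
  then obtain i where i: "i < n" "y $ i \<noteq> 0" using y by (auto simp: vec_eq_iff)
  have "0 < (\<Sum>j = 0..<n. y $ j * y $ j)"
  proof (rule sum_pos2)
    show "0 < y $ i * y $ i" using i by (simp flip: power2_eq_square)
  qed (use i in auto)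
  then show ?thesis using eq y by (simp add: scalar_prod_def)
qed

text \<open>
  Let \<open>y\<close> and \<open>z\<close> be the two resolvents applied to the all-ones vector \<open>1\<close>. The first equation,
  \<open>s1 y - t1 G y = 1\<close>, expresses \<open>G y\<close> through \<open>y\<close>, so the second matrix maps \<open>y - z\<close> to
  \<open>(s2 - t2 s1 / t1) y + (t2 / t1 - 1)\<close>. Monotonicity of the first matrix gives \<open>y > 0\<close>, so this is
  at least the positive constant \<open>t2 / t1 - 1\<close>, and monotonicity of the second matrix turns that into
  \<open>y > z\<close>.
\<close>

lemma resolvent_difference_mult_ones_pos:
  fixes G :: "real mat"
  assumes G: "G \<in> carrier_mat n n" and nn: "\<And>i j. i < n \<Longrightarrow> j < n \<Longrightarrow> 0 \<le> G $$ (i, j)"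
    and s: "0 < s1" "0 < s2" and t: "0 < t1" "t1 < t2" and less: "t2 * s1 < t1 * s2"
    and mono: "monotone_mat (s1 \<cdot>\<^sub>m 1\<^sub>m n - t1 \<cdot>\<^sub>m G)" "monotone_mat (s2 \<cdot>\<^sub>m 1\<^sub>m n - t2 \<cdot>\<^sub>m G)"
    and i: "i < n"
  shows "0 < ((inv_mat (s1 \<cdot>\<^sub>m 1\<^sub>m n - t1 \<cdot>\<^sub>m G) - inv_mat (s2 \<cdot>\<^sub>m 1\<^sub>m n - t2 \<cdot>\<^sub>m G)) *\<^sub>v ones n) $ i"
proof -
  let ?A1 = "s1 \<cdot>\<^sub>m 1\<^sub>m n - t1 \<cdot>\<^sub>m G" and ?A2 = "s2 \<cdot>\<^sub>m 1\<^sub>m n - t2 \<cdot>\<^sub>m G"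
  have A: "?A1 \<in> carrier_mat n n" "?A2 \<in> carrier_mat n n" using G by auto
  have ones: "ones n \<in> carrier_vec n" by (simp add: ones_def)
  note inv1 = inv_mat_inverts[OF A(1) mono(1)] and inv2 = inv_mat_inverts[OF A(2) mono(2)]
  define y where "y = inv_mat ?A1 *\<^sub>v ones n"
  define z where "z = inv_mat ?A2 *\<^sub>v ones n"
  have y: "y \<in> carrier_vec n" and z: "z \<in> carrier_vec n"
    using inv1 inv2 ones by (auto simp: y_def z_def)
  have A1y: "?A1 *\<^sub>v y = ones n" and A2z: "?A2 *\<^sub>v z = ones n"
    unfolding y_def z_def
    using inv_mat_mult_self[OF A(1) mono(1) ones] inv_mat_mult_self[OF A(2) mono(2) ones] by auto
  have y_pos: "0 < y $ l" if l: "l < n" for l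
  proof -
    have "1 / s1 \<le> y $ l"
      by (rule monotone_mat_mult_vec_lower_bound[OF G nn s(1) _ mono(1) _ y _ l])
        (use A1y t in \<open>auto simp: ones_def\<close>)
    moreover have "0 < 1 / s1" using s by simp
    ultimately show ?thesis by linarith
  qed
  define e where "e = t2 / t1 - 1"
  have e: "0 < e" using t by (simp add: e_def)
  have "e / s2 \<le> (y - z) $ i"
  proof (rule monotone_mat_mult_vec_lower_bound[OF G nn s(2) _ mono(2) _ _ _ i])
    fix l assume l: "l < n"
    let ?S = "\<Sum>j<n. G $$ (l, j) * y $ j"
    have "s1 * y $ l - t1 * ?S = 1"
      using shifted_scaled_mult_vec[OF G y l, of s1 t1] A1y l by (simp add: ones_def)
    then have S: "?S = (s1 * y $ l - 1) / t1" using t by (simp add: field_simps)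
    have "(?A2 *\<^sub>v (y - z)) $ l = (?A2 *\<^sub>v y) $ l - (?A2 *\<^sub>v z) $ l"
      unfolding mult_minus_distrib_mat_vec[OF A(2) y z] A2z using l by (simp add: ones_def)
    also have "\<dots> = s2 * y $ l - t2 * ?S - 1"
      unfolding shifted_scaled_mult_vec[OF G y l] A2z using l by (simp add: ones_def)
    also have "\<dots> = (t1 * s2 - t2 * s1) / t1 * y $ l + e"
      unfolding S using t by (simp add: e_def field_simps)
    finally have "(?A2 *\<^sub>v (y - z)) $ l = (t1 * s2 - t2 * s1) / t1 * y $ l + e" .
    moreover have "0 \<le> (t1 * s2 - t2 * s1) / t1 * y $ l"
      using less t y_pos[OF l] by (intro mult_nonneg_nonneg divide_nonneg_nonneg) auto
    ultimately show "e \<le> (?A2 *\<^sub>v (y - z)) $ l" by linarith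
  qed (use t e y z in auto)
  moreover have "0 < e / s2" using e s by simp
  moreover have "(inv_mat ?A1 - inv_mat ?A2) *\<^sub>v ones n = y - z"
    using minus_mult_distrib_mat_vec[OF inv1(3) inv2(3) ones] by (simp add: y_def z_def)
  ultimately show ?thesis by simp
qed

section \<open>The secant relaxation of the welfare\<close>

lemma welfare_eq_objective:
  "welfare N p = P_objective N p + (\<Sum>l = 1..num_comps N. comp_const N l)"
  by (simp add: welfare_def P_objective_def sum.distrib)

definition price_box :: "pricing_instance \<Rightarrow> (nat \<Rightarrow> real) \<Rightarrow> bool" where
  "price_box N p \<longleftrightarrow> (\<forall>l\<in>{1..num_comps N}. comp_price0A N l \<le> p l \<and> p l \<le> pmax N l)"

definition shifted_box :: "pricing_instance \<Rightarrow> (nat \<Rightarrow> real) \<Rightarrow> bool" where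
  "shifted_box N y \<longleftrightarrow>
     (\<forall>l\<in>{1..num_comps N}. shifted N (comp_price0A N) l \<le> y l \<and> y l \<le> shifted N (pmax N) l)"

text \<open>
  The secant of \<open>\<lambda>x. - comp_d N l * x\<^sup>2\<close> through the two shifted price bounds, that is, minus the
  finite branch of \<open>gconv\<close>. Writing its slope as \<open>comp_gamma\<close> exhibits the relaxation as a
  knapsack whose value densities are the quantities by which the components are ordered.
\<close>

definition secant_value :: "pricing_instance \<Rightarrow> nat \<Rightarrow> real \<Rightarrow> real" where
  "secant_value N l x = comp_gamma N l * x
     + comp_d N l * shifted N (pmax N) l * shifted N (comp_price0A N) l"

lemma P_feasible_iff:
  "P_feasible N p \<longleftrightarrow> k0 N \<le> (\<Sum>l = 1..num_comps N. comp_b N l * p l) \<and> price_box N p"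
  unfolding P_feasible_def price_box_def by auto

lemma RP_feasible_shifted_iff:
  "RP_feasible N (shifted N p) \<longleftrightarrow> k0 N \<le> (\<Sum>l = 1..num_comps N. comp_b N l * p l)"
  unfolding RP_feasible_def shifted_k0_def shifted_def
  by (simp add: right_diff_distrib sum_subtractf)

locale positive_coefficients =
  fixes N :: pricing_instance
  assumes b_pos: "\<And>l. l \<in> {1..num_comps N} \<Longrightarrow> 0 < comp_b N l"
    and q_pos: "\<And>l. l \<in> {1..num_comps N} \<Longrightarrow> 0 < comp_q N l"
begin

lemma shifted_le_iff:
  assumes "l \<in> {1..num_comps N}"
  shows "shifted N p l \<le> shifted N r l \<longleftrightarrow> p l \<le> r l"
  using b_pos[OF assms] by (simp add: shifted_def)

lemma shifted_box_iff: "shifted_box N (shifted N p) \<longleftrightarrow> price_box N p"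
  unfolding shifted_box_def price_box_def by (auto simp: shifted_le_iff)

lemma secant_slope:
  assumes l: "l \<in> {1..num_comps N}"
  shows "- comp_d N l * (shifted N (pmax N) l + shifted N (comp_price0A N) l) = comp_gamma N l"
  using b_pos[OF l] q_pos[OF l]
  by (simp add: comp_d_def shifted_def comp_gamma_def field_simps power2_eq_square)

lemma gconv_eq:
  assumes l: "l \<in> {1..num_comps N}"
  shows "gconv N l x =
    (if shifted N (comp_price0A N) l \<le> x \<and> x \<le> shifted N (pmax N) l
     then ereal (- secant_value N l x) else \<infinity>)"
  unfolding gconv_def secant_value_def secant_slope[OF l, symmetric] Let_def
  by (simp add: algebra_simps)

lemma RP_objective_in_box:
  assumes "shifted_box N y"
  shows "RP_objective N y = ereal (\<Sum>l = 1..num_comps N. secant_value N l (y l))"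
proof -
  have "(\<Sum>l = 1..num_comps N. gconv N l (y l))
      = (\<Sum>l = 1..num_comps N. ereal (- secant_value N l (y l)))"
    using assms by (intro sum.cong) (auto simp: gconv_eq shifted_box_def)
  then show ?thesis unfolding RP_objective_def by (simp add: sum_negf)
qed

lemma RP_objective_outside_box:
  assumes "\<not> shifted_box N y"
  shows "RP_objective N y = - \<infinity>"
proof -
  obtain l where "l \<in> {1..num_comps N}" "gconv N l (y l) = \<infinity>"
    using assms unfolding shifted_box_def by (metis gconv_eq)
  then have "(\<Sum>l = 1..num_comps N. gconv N l (y l)) = \<infinity>"
    unfolding sum_Pinfty by blast
  then show ?thesis unfolding RP_objective_def by simp
qed

text \<open>
  Completing the square turns the welfare into a separable sum of convex parabolas centred at 0 in
  the shifted prices, plus the same constant that enters the relaxed welfare.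
\<close>

lemma welfare_eq_shifted:
  "welfare N p = (\<Sum>l = 1..num_comps N. - comp_d N l * (shifted N p l)\<^sup>2)
     + (\<Sum>l = 1..num_comps N. comp_const N l - (comp_v N l)\<^sup>2 / (4 * comp_q N l))"
  unfolding welfare_def sum.distrib[symmetric]
proof (rule sum.cong)
  fix l assume l: "l \<in> {1..num_comps N}"
  have "- comp_d N l * (shifted N p l)\<^sup>2 = comp_q N l * (p l - comp_v N l / (2 * comp_q N l))\<^sup>2"
    using b_pos[OF l] by (simp add: comp_d_def shifted_def power_mult_distrib)
  also have "\<dots> = comp_q N l * (p l)\<^sup>2 - comp_v N l * p l + (comp_v N l)\<^sup>2 / (4 * comp_q N l)"
    using q_pos[OF l] by (simp add: power2_eq_square field_simps)
  finally show "comp_q N l * (p l)\<^sup>2 - comp_v N l * p l + comp_const N l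
      = - comp_d N l * (shifted N p l)\<^sup>2 + (comp_const N l - (comp_v N l)\<^sup>2 / (4 * comp_q N l))"
    by simp
qed simp

text \<open>
  The gap of the relaxation. It is nonnegative between the two price bounds and vanishes exactly at
  them; so the relaxation overestimates welfare, and it is tight at policies that put every component
  at one of its bounds.
\<close>

lemma secant_value_minus_square:
  assumes l: "l \<in> {1..num_comps N}"
  shows "secant_value N l x - (- comp_d N l * x\<^sup>2)
    = - comp_d N l * ((shifted N (pmax N) l - x) * (x - shifted N (comp_price0A N) l))"
  unfolding secant_value_def secant_slope[OF l, symmetric]
  by (simp add: algebra_simps power2_eq_square)

lemma relaxed_welfare_in_box:
  assumes "price_box N p"
  shows "relaxed_welfare N p = ereal ((\<Sum>l = 1..num_comps N. secant_value N l (shifted N p l))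
     + (\<Sum>l = 1..num_comps N. comp_const N l - (comp_v N l)\<^sup>2 / (4 * comp_q N l)))"
  using assms RP_objective_in_box[of "shifted N p"]
  unfolding relaxed_welfare_def shifted_box_iff by simp

lemma welfare_le_relaxed_welfare:
  assumes box: "price_box N p"
  shows "ereal (welfare N p) \<le> relaxed_welfare N p"
  unfolding relaxed_welfare_in_box[OF box] welfare_eq_shifted
proof (simp only: ereal_less_eq(3), rule add_right_mono, rule sum_mono)
  fix l assume l: "l \<in> {1..num_comps N}"
  have "0 \<le> - comp_d N l * ((shifted N (pmax N) l - shifted N p l)
      * (shifted N p l - shifted N (comp_price0A N) l))"
    using box l q_pos[OF l] shifted_le_iff[OF l]
    by (intro mult_nonneg_nonneg) (auto simp: comp_d_def price_box_def)
  then show "- comp_d N l * (shifted N p l)\<^sup>2 \<le> secant_value N l (shifted N p l)"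
    using secant_value_minus_square[OF l, of "shifted N p l"] by linarith
qed

lemma relaxed_welfare_eq_welfare:
  assumes box: "price_box N p"
    and ext: "\<And>l. l \<in> {1..num_comps N} \<Longrightarrow> p l = comp_price0A N l \<or> p l = pmax N l"
  shows "relaxed_welfare N p = ereal (welfare N p)"
  unfolding relaxed_welfare_in_box[OF box] welfare_eq_shifted
proof (simp only: ereal.inject, rule arg_cong2[where f = "(+)", OF sum.cong refl])
  fix l assume l: "l \<in> {1..num_comps N}"
  have "shifted N p l = shifted N (comp_price0A N) l \<or> shifted N p l = shifted N (pmax N) l"
    using ext[OF l] by (auto simp: shifted_def)
  then show "secant_value N l (shifted N p l) = - comp_d N l * (shifted N p l)\<^sup>2"
    using secant_value_minus_square[OF l, of "shifted N p l"] by auto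
qed simp

text \<open>
  Membership in \<open>S_L\<close> is a sign condition on the value density. Hence, in descending order of the
  densities, \<open>S_L\<close> is a final segment of the components.
\<close>

lemma gamma_nonpos_iff_S_L:
  assumes l: "l \<in> {1..num_comps N}"
  shows "l \<in> S_L N \<longleftrightarrow> comp_gamma N l \<le> 0"
proof -
  have "0 < comp_q N l / comp_b N l" using b_pos[OF l] q_pos[OF l] by simp
  then have "comp_gamma N l \<le> 0 \<longleftrightarrow> comp_price0A N l + pmax N l - comp_v N l / comp_q N l \<le> 0"
    unfolding comp_gamma_def by (metis mult_le_cancel_left_pos mult_zero_right)
  then show ?thesis using l by (auto simp: S_L_def)
qed

end

section \<open>The threshold policy solves the fractional knapsack\<close>

text \<open>
  Weak duality for a linear objective under one resource constraint: if \<open>x\<close> beats \<open>y\<close> in every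
  coordinate for the objective priced with the multiplier \<open>lam\<close>, and \<open>x\<close> satisfies complementary
  slackness, then \<open>x\<close> beats \<open>y\<close>.
\<close>

lemma lagrangian_sufficiency:
  fixes g x y :: "'a \<Rightarrow> real"
  assumes lam: "0 \<le> lam" and best: "\<And>l. l \<in> I \<Longrightarrow> 0 \<le> (g l + lam) * (x l - y l)"
    and slack: "lam * (sum x I - k) = 0" and feas: "k \<le> sum y I"
  shows "(\<Sum>l\<in>I. g l * y l) \<le> (\<Sum>l\<in>I. g l * x l)"
proof -
  have "0 \<le> (\<Sum>l\<in>I. (g l + lam) * (x l - y l))" by (rule sum_nonneg) (rule best)
  also have "\<dots> = (\<Sum>l\<in>I. g l * x l) - (\<Sum>l\<in>I. g l * y l) + lam * (sum x I - sum y I)"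
    by (simp add: algebra_simps sum.distrib sum_subtractf sum_distrib_left)
  finally have "(\<Sum>l\<in>I. g l * y l) \<le> (\<Sum>l\<in>I. g l * x l) + lam * (sum x I - sum y I)" by simp
  moreover have "lam * (sum x I - sum y I) \<le> lam * (sum x I - k)"
    using lam feas by (intro mult_left_mono) auto
  ultimately show ?thesis using slack by linarith
qed

locale ordered_components = positive_coefficients +
  assumes lower_le_upper: "\<And>l. l \<in> {1..num_comps N} \<Longrightarrow> comp_price0A N l \<le> pmax N l"
    and upper_feasible: "k0 N \<le> (\<Sum>l = 1..num_comps N. comp_b N l * pmax N l)"
    and gamma_antimono: "antimono_on {1..num_comps N} (comp_gamma N)"
begin

abbreviation threshold_load :: "nat \<Rightarrow> real" where
  "threshold_load l \<equiv> \<Sum>m = 1..num_comps N. comp_b N m * threshold_policy N l m"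

lemma gamma_le:
  assumes "l \<in> {1..num_comps N}" "m \<in> {1..num_comps N}" "l \<le> m"
  shows "comp_gamma N m \<le> comp_gamma N l"
  using gamma_antimono assms by (auto simp: monotone_on_def)

text \<open>
  As \<open>S_L\<close> is a final segment and \<open>ell'\<close> is one past the last component if it is empty, the
  interval form holds in that case too.
\<close>

lemma ell'_bounds: "1 \<le> ell' N" "ell' N \<le> num_comps N + 1"
  and S_L_eq: "S_L N = {ell' N..num_comps N}"
proof -
  have sub: "S_L N \<subseteq> {1..num_comps N}" by (auto simp: S_L_def)
  then have fin: "finite (S_L N)" by (rule finite_subset) simp
  show "1 \<le> ell' N" "ell' N \<le> num_comps N + 1" "S_L N = {ell' N..num_comps N}"
  proof (atomize (full), cases "S_L N = {}")
    case True
    then show "1 \<le> ell' N \<and> ell' N \<le> num_comps N + 1 \<and> S_L N = {ell' N..num_comps N}"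
      by (simp add: ell'_def)
  next
    case False
    then have eq: "ell' N = Min (S_L N)" by (simp add: ell'_def)
    have mem: "ell' N \<in> S_L N" unfolding eq using fin False by simp
    have "l \<in> S_L N" if "ell' N \<le> l" "l \<le> num_comps N" for l
    proof -
      have "l \<in> {1..num_comps N}" "ell' N \<in> {1..num_comps N}" using that mem sub by auto
      then show ?thesis
        using gamma_le[of "ell' N" l] that mem gamma_nonpos_iff_S_L by fastforce
    qed
    moreover have "ell' N \<le> l" if "l \<in> S_L N" for l using fin that by (simp add: eq)
    ultimately show "1 \<le> ell' N \<and> ell' N \<le> num_comps N + 1 \<and> S_L N = {ell' N..num_comps N}"
      using mem sub by auto
  qed
qed

lemma gamma_sign:
  assumes "l \<in> {1..num_comps N}"
  shows "l < ell' N \<Longrightarrow> 0 \<le> comp_gamma N l" "ell' N \<le> l \<Longrightarrow> comp_gamma N l \<le> 0"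
  using gamma_nonpos_iff_S_L[OF assms] assms by (auto simp: S_L_eq)

text \<open>
  The set over which \<open>ell_star\<close> is a minimum is nonempty: raising every component to its upper bound
  meets the resource constraint.
\<close>

lemma ell_star_props:
  shows "ell_star N \<in> {ell' N - 1..num_comps N}" "k0 N \<le> threshold_load (ell_star N)"
    and "\<And>l. ell' N - 1 \<le> l \<Longrightarrow> l < ell_star N \<Longrightarrow> threshold_load l < k0 N"
proof -
  define E where "E = {l \<in> S_L N \<union> {ell' N - 1}. k0 N \<le> threshold_load l}"
  have star: "ell_star N = Min E" by (simp add: ell_star_def E_def)
  have cand: "S_L N \<union> {ell' N - 1} = {ell' N - 1..num_comps N}"
    using ell'_bounds by (auto simp: S_L_eq)
  have fin: "finite E" unfolding E_def cand by simp
  have "threshold_load (num_comps N) = (\<Sum>l = 1..num_comps N. comp_b N l * pmax N l)"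
    by (intro sum.cong) (auto simp: threshold_policy_def)
  then have "num_comps N \<in> E"
    unfolding E_def cand using upper_feasible ell'_bounds by auto
  then have mem: "ell_star N \<in> E" unfolding star using fin Min_in by blast
  then show "ell_star N \<in> {ell' N - 1..num_comps N}" "k0 N \<le> threshold_load (ell_star N)"
    unfolding E_def cand by auto
  fix l assume l: "ell' N - 1 \<le> l" "l < ell_star N"
  then have "l \<notin> E" unfolding star using fin by (meson Min_le leD)
  then show "threshold_load l < k0 N"
    using l mem unfolding E_def cand by auto
qed

lemma threshold_policy_in_box: "price_box N (threshold_policy N l)"
  using lower_le_upper by (auto simp: price_box_def threshold_policy_def)

text \<open>
  Here \<open>ell_star\<close> is not the first candidate, so the threshold policy just before it is a candidate
  that violates the resource constraint. The price of component \<open>ell_star\<close> that makes the constraint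
  tight is therefore strictly above the lower bound, while feasibility of the threshold policy at
  \<open>ell_star\<close> keeps it at or below the upper bound.
\<close>

lemma pbar_fractional:
  assumes ne: "ell_star N \<noteq> ell' N - 1"
  shows "ell' N \<le> ell_star N" "ell_star N \<in> {1..num_comps N}"
    and "\<And>m. m \<noteq> ell_star N \<Longrightarrow> pbar N m = threshold_policy N (ell_star N) m"
    and "comp_price0A N (ell_star N) < pbar N (ell_star N)"
    and "pbar N (ell_star N) \<le> pmax N (ell_star N)"
    and "(\<Sum>l = 1..num_comps N. comp_b N l * pbar N l) = k0 N"
proof -
  let ?s = "ell_star N"
  note star = ell_star_props
  show s: "ell' N \<le> ?s" "?s \<in> {1..num_comps N}" using star(1) ne ell'_bounds by auto
  define rest where
    "rest = (\<Sum>m\<in>{1..num_comps N} - {?s}. comp_b N m * threshold_policy N ?s m)"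
  have p_s: "pbar N ?s = (k0 N - rest) / comp_b N ?s" using ne by (simp add: pbar_def rest_def)
  show p_other: "\<And>m. m \<noteq> ?s \<Longrightarrow> pbar N m = threshold_policy N ?s m"
    using ne by (simp add: pbar_def)
  have split: "(\<Sum>m = 1..num_comps N. f m) = f ?s + (\<Sum>m\<in>{1..num_comps N} - {?s}. f m)"
    for f :: "nat \<Rightarrow> real"
    using s by (intro sum.remove) auto
  have upper: "threshold_load ?s = comp_b N ?s * pmax N ?s + rest"
    unfolding split rest_def by (simp add: threshold_policy_def)
  have "(\<Sum>m\<in>{1..num_comps N} - {?s}. comp_b N m * threshold_policy N (?s - 1) m) = rest"
    unfolding rest_def by (intro sum.cong) (auto simp: threshold_policy_def)
  moreover have "\<not> ?s \<le> ?s - 1" using s by auto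
  ultimately have lower: "threshold_load (?s - 1) = comp_b N ?s * comp_price0A N ?s + rest"
    unfolding split using \<open>\<not> ?s \<le> ?s - 1\<close> by (simp add: threshold_policy_def)
  have "ell' N - 1 \<le> ?s - 1" "?s - 1 < ?s" using s by auto
  then have "threshold_load (?s - 1) < k0 N" by (rule star(3))
  then show "comp_price0A N ?s < pbar N ?s"
    unfolding p_s lower using b_pos[OF s(2)] by (simp add: pos_less_divide_eq mult.commute)
  show "pbar N ?s \<le> pmax N ?s"
    unfolding p_s using star(2) b_pos[OF s(2)] unfolding upper
    by (simp add: pos_divide_le_eq mult.commute)
  have "(\<Sum>m\<in>{1..num_comps N} - {?s}. comp_b N m * pbar N m) = rest"
    unfolding rest_def by (intro sum.cong) (auto simp: p_other)
  then show "(\<Sum>l = 1..num_comps N. comp_b N l * pbar N l) = k0 N"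
    unfolding split p_s using b_pos[OF s(2)] by simp
qed

lemma pbar_in_box: "price_box N (pbar N)"
proof (cases "ell_star N = ell' N - 1")
  case True
  then show ?thesis using threshold_policy_in_box by (simp add: pbar_def)
next
  case False
  show ?thesis unfolding price_box_def
  proof
    fix l assume "l \<in> {1..num_comps N}"
    then show "comp_price0A N l \<le> pbar N l \<and> pbar N l \<le> pmax N l"
      using pbar_fractional(3-5)[OF False] threshold_policy_in_box[of "ell_star N"]
      by (cases "l = ell_star N") (auto simp: price_box_def)
  qed
qed

lemma pbar_load: "k0 N \<le> (\<Sum>l = 1..num_comps N. comp_b N l * pbar N l)"
proof (cases "ell_star N = ell' N - 1")
  case True
  then show ?thesis using ell_star_props(2) by (simp add: pbar_def)
next
  case False
  then show ?thesis using pbar_fractional(6) by simp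
qed

text \<open>
  The multiplier of the resource constraint is 0 if raising exactly the components of positive
  density already meets it, and otherwise minus the density of \<open>ell_star\<close>, the last component to be
  raised and the only one that may end between its bounds. In both cases the density plus the
  multiplier is nonnegative for the other components that are raised, nonpositive for those that
  stay at their lower bound, and in the second case it vanishes at \<open>ell_star\<close>.
\<close>

lemma pbar_maximizes_linear:
  assumes box: "shifted_box N y" and feas: "RP_feasible N y"
  shows "(\<Sum>l = 1..num_comps N. comp_gamma N l * y l)
    \<le> (\<Sum>l = 1..num_comps N. comp_gamma N l * shifted N (pbar N) l)"
proof -
  have at_upper: "y l \<le> shifted N (pbar N) l"
    if "l \<in> {1..num_comps N}" "pbar N l = pmax N l" for l
    using box that by (simp add: shifted_box_def shifted_def)
  have at_lower: "shifted N (pbar N) l \<le> y l"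
    if "l \<in> {1..num_comps N}" "pbar N l = comp_price0A N l" for l
    using box that by (simp add: shifted_box_def shifted_def)
  have y_load: "shifted_k0 N \<le> sum y {1..num_comps N}" using feas by (simp add: RP_feasible_def)
  show ?thesis
  proof (cases "ell_star N = ell' N - 1")
    case True
    show ?thesis
    proof (rule lagrangian_sufficiency[where lam = 0 and k = "shifted_k0 N", OF _ _ _ y_load])
      fix l assume l: "l \<in> {1..num_comps N}"
      show "0 \<le> (comp_gamma N l + 0) * (shifted N (pbar N) l - y l)"
      proof (cases "l < ell' N")
        case less: True
        have "l \<le> ell' N - 1" using less by linarith
        then have "pbar N l = pmax N l" using True by (simp add: pbar_def threshold_policy_def)
        from at_upper[OF l this] show ?thesis using gamma_sign(1)[OF l less] by simp
      next
        case ge: False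
        have "pbar N l = comp_price0A N l"
          using True ge l ell'_bounds by (auto simp: pbar_def threshold_policy_def)
        from at_lower[OF l this] show ?thesis
          using gamma_sign(2)[OF l] ge by (simp add: mult_nonpos_nonpos)
      qed
    qed auto
  next
    case False
    let ?s = "ell_star N"
    note frac = pbar_fractional[OF False]
    show ?thesis
    proof (rule lagrangian_sufficiency[where lam = "- comp_gamma N ?s" and k = "shifted_k0 N",
          OF _ _ _ y_load])
      show "0 \<le> - comp_gamma N ?s" using gamma_sign(2)[OF frac(2,1)] by simp
      have "sum (shifted N (pbar N)) {1..num_comps N} = shifted_k0 N"
        using frac(6) unfolding shifted_k0_def shifted_def
        by (simp add: right_diff_distrib sum_subtractf)
      then show "- comp_gamma N ?s * (sum (shifted N (pbar N)) {1..num_comps N} - shifted_k0 N) = 0"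
        by simp
      fix l assume l: "l \<in> {1..num_comps N}"
      consider "l < ?s" | "l = ?s" | "?s < l" by linarith
      then show "0 \<le> (comp_gamma N l + - comp_gamma N ?s) * (shifted N (pbar N) l - y l)"
      proof cases
        case 1
        then have "pbar N l = pmax N l" using frac(3)[of l] by (simp add: threshold_policy_def)
        from at_upper[OF l this] show ?thesis using gamma_le[OF l frac(2)] 1 by simp
      next
        case 2
        then show ?thesis by simp
      next
        case 3
        then have "pbar N l = comp_price0A N l" using frac(3)[of l] by (simp add: threshold_policy_def)
        from at_lower[OF l this] show ?thesis
          using gamma_le[OF frac(2) l] 3 by (simp add: mult_nonpos_nonpos)
      qed
    qed
  qed
qed

lemma RP_objective_le_pbar:
  assumes "RP_feasible N y"
  shows "RP_objective N y \<le> RP_objective N (shifted N (pbar N))"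
proof (cases "shifted_box N y")
  case True
  have "shifted_box N (shifted N (pbar N))" using pbar_in_box by (simp add: shifted_box_iff)
  from RP_objective_in_box[OF True] RP_objective_in_box[OF this] show ?thesis
    using pbar_maximizes_linear[OF True assms] by (simp add: secant_value_def sum.distrib)
next
  case False
  then show ?thesis by (simp add: RP_objective_outside_box)
qed

lemma pbar_RP_optimal: "RP_optimal N (shifted N (pbar N))"
  unfolding RP_optimal_def is_arg_max_def RP_feasible_shifted_iff
  using pbar_load RP_objective_le_pbar by (auto simp: not_less)

lemma relaxed_welfare_le_pbar:
  assumes "RP_feasible N (shifted N p)"
  shows "relaxed_welfare N p \<le> relaxed_welfare N (pbar N)"
  unfolding relaxed_welfare_def by (intro add_right_mono RP_objective_le_pbar assms)

lemma welfare_le_relaxed_pbar: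
  assumes "P_feasible N p"
  shows "ereal (welfare N p) \<le> relaxed_welfare N (pbar N)"
  using assms welfare_le_relaxed_welfare relaxed_welfare_le_pbar order_trans
  unfolding P_feasible_iff RP_feasible_shifted_iff by blast

text \<open>
  In the fractional case the price at \<open>ell_star\<close> lies strictly above its lower bound, so the
  hypothesis can only mean the upper bound. The value \<open>ell_star N = 0\<close> belongs to the other case, as
  0 is not a component.
\<close>

lemma pbar_eq_threshold:
  assumes "ell_star N = 0 \<or>
    pbar N (ell_star N) \<in> {comp_price0A N (ell_star N), pmax N (ell_star N)}"
  shows "pbar N = threshold_policy N (ell_star N)"
proof (cases "ell_star N = ell' N - 1")
  case True
  then show ?thesis by (simp add: pbar_def)
next
  case False
  note frac = pbar_fractional[OF False]
  have "pbar N (ell_star N) = pmax N (ell_star N)" using assms frac(2,4) by auto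
  then have "pbar N m = threshold_policy N (ell_star N) m" for m
    using frac(3) by (cases "m = ell_star N") (simp_all add: threshold_policy_def)
  then show ?thesis by blast
qed

end

section \<open>Positivity of the component coefficients\<close>

lemma connected_comp_props:
  assumes "V \<in> connected_comps G"
  shows "V \<subseteq> {..<dim_row G}" "V \<noteq> {}"
proof -
  obtain i where i: "i < dim_row G" and V: "V = (adj_rel G)\<^sup>* `` {i}"
    using assms by (auto simp: connected_comps_def quotient_def)
  have "j < dim_row G" if "(i, j) \<in> (adj_rel G)\<^sup>*" for j
    using that i by (induction rule: rtrancl_induct) (auto simp: adj_rel_def)
  then show "V \<subseteq> {..<dim_row G}" "V \<noteq> {}" unfolding V by auto
qed

lemma transpose_shifted_scaled:
  fixes H :: "real mat"
  assumes H: "H \<in> carrier_mat n n" and sym: "\<And>i j. i < n \<Longrightarrow> j < n \<Longrightarrow> H $$ (i, j) = H $$ (j, i)"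
  shows "(s \<cdot>\<^sub>m 1\<^sub>m n - t \<cdot>\<^sub>m H)\<^sup>T = s \<cdot>\<^sub>m 1\<^sub>m n - t \<cdot>\<^sub>m H"
  by (rule eq_matI) (use assms in auto)

text \<open>
  Both shifted matrices are monotone by the spectral bound, and so are their restrictions to a
  component. The condition \<open>mu < beta delta\<close> is what makes the two resolvents comparable: it is
  equivalent to \<open>(delta + mu) / (1 + beta) < (delta - mu) / (1 - beta)\<close>, and as
  \<open>beta delta < delta\<close> it also makes \<open>delta - mu\<close> positive.
\<close>

lemma positive_coefficients_of_spectral_bound:
  fixes N :: pricing_instance
  assumes G: "adj N \<in> carrier_mat (agents N) (agents N)"
    and entries: "\<forall>i<agents N. \<forall>j<agents N. adj N $$ (i, j) \<in> {0, 1}"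
    and sym: "\<forall>i<agents N. \<forall>j<agents N. adj N $$ (i, j) = adj N $$ (j, i)"
    and comps: "verts N ` {1..num_comps N} \<subseteq> connected_comps (adj N)"
    and pars: "0 < beta N" "beta N < 1" "0 < delta N" "0 < mu N"
    and spectral: "max (\<bar>delta N + mu N\<bar> / (1 + beta N)) (\<bar>delta N - mu N\<bar> / (1 - beta N))
           * spectral_radius (map_mat complex_of_real (adj N)) < 1"
    and mu_less: "mu N < beta N * delta N"
  shows "positive_coefficients N"
proof -
  let ?n = "agents N" and ?G = "adj N"
  let ?r = "spectral_radius (map_mat complex_of_real ?G)"
  let ?A = "\<lambda>H. (1 - beta N) \<cdot>\<^sub>m 1\<^sub>m (dim_row H) - (delta N - mu N) \<cdot>\<^sub>m H"
  let ?B = "\<lambda>H. (1 + beta N) \<cdot>\<^sub>m 1\<^sub>m (dim_row H) - (delta N + mu N) \<cdot>\<^sub>m H"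
  have nn: "0 \<le> ?G $$ (i, j)" if "i < ?n" "j < ?n" for i j using entries that by fastforce
  have dim: "dim_row ?G = ?n" using G by simp
  have "beta N * delta N < delta N" using pars by simp
  then have diff: "0 < delta N - mu N" using mu_less by linarith
  have monoA: "monotone_mat (?A ?G)" and monoB: "monotone_mat (?B ?G)" if n: "0 < ?n"
  proof -
    have r: "0 \<le> ?r" using spectral_radius_nonneg[of _ ?n] G n by simp
    let ?c = "max (\<bar>delta N + mu N\<bar> / (1 + beta N)) (\<bar>delta N - mu N\<bar> / (1 - beta N))"
    have c: "(delta N - mu N) / (1 - beta N) \<le> ?c" "(delta N + mu N) / (1 + beta N) \<le> ?c"
      using diff pars by auto
    have less: "(delta N - mu N) / (1 - beta N) * ?r < 1"
      "(delta N + mu N) / (1 + beta N) * ?r < 1"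
      using mult_right_mono[OF c(1) r] mult_right_mono[OF c(2) r] spectral by linarith+
    show "monotone_mat (?A ?G)" unfolding dim
      by (rule monotone_mat_resolvent[OF G nn _ _ less(1)]) (use pars diff in auto)
    show "monotone_mat (?B ?G)" unfolding dim
      by (rule monotone_mat_resolvent[OF G nn _ _ less(2)]) (use pars diff in auto)
  qed
  show ?thesis
  proof
    fix l assume l: "l \<in> {1..num_comps N}"
    define V where "V = verts N l"
    have "V \<in> connected_comps ?G" using comps l by (auto simp: V_def)
    then have V: "V \<subseteq> {..<?n}" "V \<noteq> {}"
      using connected_comp_props[of V ?G] dim by simp_all
    then have fin: "finite V" and n: "0 < ?n" using finite_subset by auto
    note mono = monoA[OF n] monoB[OF n]
    have less: "(delta N + mu N) * (1 - beta N) < (delta N - mu N) * (1 + beta N)"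
      using mu_less by (simp add: algebra_simps)
    have "0 < bdelta N $ i" if "i < ?n" for i
      using resolvent_difference_mult_ones_pos[OF G nn _ _ diff _ less
          mono[unfolded dim] that] pars
      unfolding bdelta_def Mdelta_def Mminus_def Mplus_def Mminus_of_def Mplus_of_def dim by simp
    then show "0 < comp_b N l"
      unfolding comp_b_def V_def[symmetric] using V fin by (intro sum_pos) auto
    let ?m = "card V" and ?H = "submatrix ?G V V"
    have m: "0 < ?m" using V fin by (simp add: card_gt_0_iff)
    have H: "?H \<in> carrier_mat ?m ?m" by (rule submatrix_carrier[OF G V(1)])
    have dimH: "dim_row ?H = ?m" using H by simp
    have sub: "{i. i < dim_row ?G \<and> i \<in> V} = V" "{i. i < dim_col ?G \<and> i \<in> V} = V"
      using V G by auto
    have "pick V i < ?n" if "i < ?m" for i using pick_in_set[of i V] that V by auto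
    then have symH: "?H $$ (i, j) = ?H $$ (j, i)" if "i < ?m" "j < ?m" for i j
      using that submatrix_index[of i ?G V j V] submatrix_index[of j ?G V i V] sym
      unfolding sub by simp
    have "monotone_mat ((1 - beta N) \<cdot>\<^sub>m 1\<^sub>m ?m - (delta N - mu N) \<cdot>\<^sub>m ?H)"
      by (rule monotone_mat_principal_submatrix[OF G nn V(1) _ _ mono(1)[unfolded dim]])
        (use pars diff in simp_all)
    moreover have "monotone_mat ((1 + beta N) \<cdot>\<^sub>m 1\<^sub>m ?m - (delta N + mu N) \<cdot>\<^sub>m ?H)"
      by (rule monotone_mat_principal_submatrix[OF G nn V(1) _ _ mono(2)[unfolded dim]])
        (use pars in simp_all)
    ultimately have monoH: "monotone_mat (?A ?H)" "monotone_mat (?B ?H)" unfolding dimH by auto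
    have carr: "?A ?H \<in> carrier_mat ?m ?m" "?B ?H \<in> carrier_mat ?m ?m" using H by auto
    have ones: "ones ?m \<in> carrier_vec ?m" "ones ?m \<noteq> 0\<^sub>v ?m"
      using m by (auto simp: ones_def vec_eq_iff)
    let ?P = "inv_mat (?B ?H)" and ?M = "inv_mat (?A ?H)"
    have P: "?P ^\<^sub>m 2 \<in> carrier_mat ?m ?m" and M: "?M ^\<^sub>m 2 \<in> carrier_mat ?m ?m"
      using inv_mat_inverts(3)[OF carr(1) monoH(1)] inv_mat_inverts(3)[OF carr(2) monoH(2)]
      by (auto intro!: pow_carrier_mat)
    have pos: "0 < ones ?m \<bullet> (?P ^\<^sub>m 2 *\<^sub>v ones ?m)" "0 < ones ?m \<bullet> (?M ^\<^sub>m 2 *\<^sub>v ones ?m)"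
      using square_quadratic_form_pos[OF carr(2) monoH(2) _ ones]
        square_quadratic_form_pos[OF carr(1) monoH(1) _ ones]
        transpose_shifted_scaled[OF H symH] unfolding dimH by auto
    have Q: "comp_Q N l = (1 + beta N) \<cdot>\<^sub>m (?P ^\<^sub>m 2) + (1 - beta N) \<cdot>\<^sub>m (?M ^\<^sub>m 2)"
      unfolding comp_Q_def comp_Mplus_def comp_Mminus_def Mplus_of_def Mminus_of_def
        comp_adj_def V_def by simp
    have "comp_Q N l *\<^sub>v ones ?m
        = (1 + beta N) \<cdot>\<^sub>v (?P ^\<^sub>m 2 *\<^sub>v ones ?m) + (1 - beta N) \<cdot>\<^sub>v (?M ^\<^sub>m 2 *\<^sub>v ones ?m)"
      unfolding Q using add_mult_distrib_mat_vec[of "(1 + beta N) \<cdot>\<^sub>m (?P ^\<^sub>m 2)" ?m ?m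
          "(1 - beta N) \<cdot>\<^sub>m (?M ^\<^sub>m 2)" "ones ?m"] P M ones
        smult_mat_mult_vec[OF P ones(1)] smult_mat_mult_vec[OF M ones(1)] by simp
    then have "comp_q N l = (1 + beta N) * (ones ?m \<bullet> (?P ^\<^sub>m 2 *\<^sub>v ones ?m))
        + (1 - beta N) * (ones ?m \<bullet> (?M ^\<^sub>m 2 *\<^sub>v ones ?m))"
      unfolding comp_q_def V_def[symmetric]
      using P M ones scalar_prod_add_distrib[of "ones ?m" ?m] by simp
    then show "0 < comp_q N l"
      using pos pars by (simp add: add_pos_pos)
  qed
qed

theorem theorem8:
  fixes N :: pricing_instance
  assumes "0 < agents N"
    and "adj N \<in> carrier_mat (agents N) (agents N)"
    and "\<forall>i<agents N. \<forall>j<agents N. adj N $$ (i, j) \<in> {0, 1}"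
    and "\<forall>i<agents N. \<forall>j<agents N. adj N $$ (i, j) = adj N $$ (j, i)"
    and "\<forall>i<agents N. adj N $$ (i, i) = 0"
    and "bij_betw (verts N) {1..num_comps N} (connected_comps (adj N))"
    and "0 < beta N" and "beta N < 1" and "0 < delta N" and "0 < mu N"
    and "price0A N \<in> carrier_vec (agents N)" and "\<forall>i<agents N. 0 \<le> price0A N $ i"
    and "\<forall>l\<in>{1..num_comps N}. \<forall>i\<in>verts N l. price0A N $ i = comp_price0A N l"
    and "price0B N \<in> carrier_vec (agents N)" and "\<forall>i<agents N. 0 \<le> price0B N $ i"
    and "0 \<le> tol N"
    and "\<forall>l\<in>{1..num_comps N}. comp_price0A N l \<le> pmax N l"
    and "max (\<bar>delta N + mu N\<bar> / (1 + beta N)) (\<bar>delta N - mu N\<bar> / (1 - beta N))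
           * spectral_radius (map_mat complex_of_real (adj N)) < 1"
    and "mu N < beta N * delta N"
    and "\<forall>i<agents N. 0 < xA0 N $ i" and "\<forall>i<agents N. 0 < xB0 N $ i"
    and "\<forall>l\<in>{1..num_comps N}. \<forall>i\<in>verts N l. pmax N l \<le> plim N $ i"
    and "(\<Sum>l = 1..num_comps N. comp_b N l * pmax N l) \<ge> k0 N"
    and "antimono_on {1..num_comps N} (comp_gamma N)"
    and "\<forall>l\<in>{1..num_comps N}. comp_price0A N l + pmax N l \<noteq> comp_v N l / comp_q N l"
  shows "(P_optimal N (pbar N) \<or> RP_optimal N (shifted N (pbar N))) \<and>
    is_arg_max (relaxed_welfare N) (\<lambda>p. RP_feasible N (shifted N p)) (pbar N) \<and>
    (\<forall>pstar. P_optimal N pstar \<longrightarrow> ereal (welfare N pstar) \<le> relaxed_welfare N (pbar N)) \<and>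
    (ell_star N = 0 \<or>
       pbar N (ell_star N) \<in> {comp_price0A N (ell_star N), pmax N (ell_star N)} \<longrightarrow>
     (\<forall>pstar. P_optimal N pstar \<longrightarrow> ereal (welfare N pstar) = relaxed_welfare N (pbar N)) \<and>
     (\<forall>m\<in>{1..num_comps N}. pbar N m = threshold_policy N (ell_star N) m) \<and>
     P_optimal N (threshold_policy N (ell_star N)))"
proof -
  have "positive_coefficients N"
    by (rule positive_coefficients_of_spectral_bound[OF assms(2-4) _ assms(7-10,18,19)])
      (use assms(6) in \<open>simp add: bij_betw_def\<close>)
  then interpret positive_coefficients N .
  interpret ordered_components N
  proof
    show "comp_price0A N l \<le> pmax N l" if "l \<in> {1..num_comps N}" for l
      using assms(17) that by blast
  qed (rule assms(23), rule assms(24))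
  let ?tight = "ell_star N = 0 \<or>
       pbar N (ell_star N) \<in> {comp_price0A N (ell_star N), pmax N (ell_star N)}"
  have eq: "pbar N = threshold_policy N (ell_star N)" if ?tight
    using that by (rule pbar_eq_threshold)
  have attained: "relaxed_welfare N (pbar N) = ereal (welfare N (pbar N))" if ?tight
    using pbar_in_box
  proof (rule relaxed_welfare_eq_welfare)
    show "pbar N l = comp_price0A N l \<or> pbar N l = pmax N l" for l
      unfolding eq[OF that] threshold_policy_def by simp
  qed
  have feas: "P_feasible N (pbar N)"
    unfolding P_feasible_iff using pbar_load pbar_in_box by simp
  have best: "P_objective N p \<le> P_objective N (pbar N)" if ?tight "P_feasible N p" for p
    using welfare_le_relaxed_pbar[OF that(2)] unfolding attained[OF that(1)]
    by (simp add: welfare_eq_objective)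
  have P_optimal_iff: "P_optimal N p \<longleftrightarrow>
      P_feasible N p \<and> (\<forall>r. P_feasible N r \<longrightarrow> P_objective N r \<le> P_objective N p)" for p
    unfolding P_optimal_def is_arg_max_linorder ..
  show ?thesis
  proof (intro conjI allI impI)
    show "P_optimal N (pbar N) \<or> RP_optimal N (shifted N (pbar N))"
      using pbar_RP_optimal ..
    show "is_arg_max (relaxed_welfare N) (\<lambda>p. RP_feasible N (shifted N p)) (pbar N)"
      unfolding is_arg_max_linorder RP_feasible_shifted_iff
      using relaxed_welfare_le_pbar[unfolded RP_feasible_shifted_iff] pbar_load by blast
  next
    fix pstar assume "P_optimal N pstar"
    then show "ereal (welfare N pstar) \<le> relaxed_welfare N (pbar N)"
      unfolding P_optimal_iff using welfare_le_relaxed_pbar by blast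
  next
    fix pstar assume t: ?tight and "P_optimal N pstar"
    then have "P_objective N pstar = P_objective N (pbar N)"
      unfolding P_optimal_iff using feas best[OF t] by (meson antisym)
    then show "ereal (welfare N pstar) = relaxed_welfare N (pbar N)"
      unfolding attained[OF t] by (simp add: welfare_eq_objective)
  next
    assume t: ?tight
    show "\<forall>m\<in>{1..num_comps N}. pbar N m = threshold_policy N (ell_star N) m"
      unfolding eq[OF t] by simp
    show "P_optimal N (threshold_policy N (ell_star N))"
      unfolding eq[OF t, symmetric] P_optimal_iff using feas best[OF t] by blast
  qed
qed

end
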